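(* Let $\mathbb{F}$ be a field of characteristic not $2$, let $\eta\in\mathbb{F}\setminus\{0,1\}$, and let $A$ be a primitive axial algebra of Jordan type $\eta$ over $\mathbb{F}$, generated by a closed set $\mathcal{A}$ of $\eta$-axes with $|\mathcal{A}|>1$. Suppose that the graph $\Delta_{\mathcal{A}}$ is connected. Let $D:=\{\tau_a\mid a\in\mathcal{A}\}$ and let $G=\langle D\rangle$ be the subgroup of $\mathrm{Aut}(A)$ generated by $D$. Assume that the map $a\mapsto\tau_a$ on $\mathcal{A}$ is injective and that $D$ is a set of $3$-transpositions in $G$. Then $A$ is a quotient of the Matsuo algebra $M_{\frac{\eta}{2}}(G,D)$ over $\mathbb{F}$; that is, there is a surjective $\mathbb{F}$-algebra homomorphism $M_{\frac{\eta}{2}}(G,D)\to A$.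
   Context: Algebras are commutative, not necessarily associative (and not necessarily finite dimensional or unital) over a field $\mathbb{F}$ of characteristic not $2$. For $a\in A$, $\mathrm{ad}_a\colon A\to A$ is $x\mapsto xa$, and $A_\lambda(a)=\{x\in A\mid xa=\lambda x\}$ for $\lambda\in\mathbb{F}$ (possibly $0$). Fix $\eta\in\mathbb{F}\setminus\{0,1\}$. An $\eta$-axis of $A$ is a nonzero idempotent $a\in A$ such that: (1) the minimal polynomial of $\mathrm{ad}_a$ exists and divides $(x-1)x(x-\eta)$, so $A=A_1(a)\oplus A_0(a)\oplus A_\eta(a)$; (2) the fusion rules hold: $A_1(a)A_1(a)\subseteq A_1(a)$, $A_0(a)A_0(a)\subseteq A_0(a)$, $A_1(a)A_0(a)=\{0\}$, $(A_0(a)+A_1(a))A_\eta(a)\subseteq A_\eta(a)$, $A_\eta(a)^2\subseteq A_0(a)+A_1(a)$; (3) $A_1(a)=\mathbb{F}a$. A primitive axial algebra of Jordan type $\eta$ is an algebra generated by $\eta$-axes. For an $\eta$-axis $a$, the Miyamoto involution $\tau_a$ is the map $A\to A$ that is the identity on $A_1(a)\oplus A_0(a)$ and $-1$ on $A_\eta(a)$; it is an automorphism of $A$ of order $1$ or $2$. The image of $x$ under a map $\psi$ is written $x^\psi$. A set $\mathcal{A}$ of $\eta$-axes is closed if $a^{\tau_b}\in\mathcal{A}$ for all $a,b\in\mathcal{A}$. $\Delta_{\mathcal{A}}$ is the graph with vertex set $\mathcal{A}$ in which distinct $a,b$ are adjacent iff $ab\neq 0$. If $G$ is a group generated by a normal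 set $D$ of involutions (i.e. $D$ is invariant under conjugation by $G$), $D$ is a set of $3$-transpositions in $G$ if $st$ has order $|st|\in\{1,2,3\}$ for all $s,t\in D$. For such a pair $(G,D)$ and $\delta\in\mathbb{F}$, the Matsuo algebra $M_\delta(G,D)$ is the $\mathbb{F}$-vector space with basis $D$ and bilinear multiplication given on $x,y\in D$ by: $x\cdot y=x$ if $y=x$; $x\cdot y=0$ if $|xy|=2$; $x\cdot y=\delta(x+y-x^y)$ if $|xy|=3$, where $x^y=y^{-1}xy$. *)

theory Defs
  imports
    "HOL-Computational_Algebra.Polynomial"
    "HOL-Library.Poly_Mapping"
    "HOL-Algebra.Multiplicative_Group"
    "HOL-Algebra.Elementary_Groups"
begin

text \<open>
  Algebras are given by a vector space structure sc on a whole type together with a product m.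
  They need be neither associative nor unital nor finite dimensional.
\<close>

locale comm_nonassoc_algebra = vector_space sc
  for sc :: "'f::field \<Rightarrow> 'a::ab_group_add \<Rightarrow> 'a" +
  fixes m :: "'a \<Rightarrow> 'a \<Rightarrow> 'a"
  assumes m_add_left: "m (x + y) z = m x z + m y z"
    and m_scale_left: "m (sc c x) y = sc c (m x y)"
    and m_commute: "m x y = m y x"

definition subalgebra :: "('f::field \<Rightarrow> 'a::ab_group_add \<Rightarrow> 'a) \<Rightarrow> ('a \<Rightarrow> 'a \<Rightarrow> 'a) \<Rightarrow> 'a set \<Rightarrow> bool"
  where "subalgebra sc m S \<longleftrightarrow> module.subspace sc S \<and> (\<forall>x\<in>S. \<forall>y\<in>S. m x y \<in> S)"

definition algebra_hom_on ::
  "'a set \<Rightarrow> ('f::field \<Rightarrow> 'a::ab_group_add \<Rightarrow> 'a) \<Rightarrow> ('a \<Rightarrow> 'a \<Rightarrow> 'a) \<Rightarrow>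
   ('f \<Rightarrow> 'b::ab_group_add \<Rightarrow> 'b) \<Rightarrow> ('b \<Rightarrow> 'b \<Rightarrow> 'b) \<Rightarrow> ('a \<Rightarrow> 'b) \<Rightarrow> bool"
  where "algebra_hom_on M sc1 m1 sc2 m2 \<phi> \<longleftrightarrow>
    (\<forall>x\<in>M. \<forall>y\<in>M. \<phi> (x + y) = \<phi> x + \<phi> y) \<and>
    (\<forall>c. \<forall>x\<in>M. \<phi> (sc1 c x) = sc2 c (\<phi> x)) \<and>
    (\<forall>x\<in>M. \<forall>y\<in>M. \<phi> (m1 x y) = m2 (\<phi> x) (\<phi> y))"

text \<open>
  Maps act on the right, so the product of f and g is ``first f, then g''.
\<close>

definition Aut_alg ::
  "('f::field \<Rightarrow> 'a::ab_group_add \<Rightarrow> 'a) \<Rightarrow> ('a \<Rightarrow> 'a \<Rightarrow> 'a) \<Rightarrow> ('a \<Rightarrow> 'a) monoid"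
  where "Aut_alg sc m =
    \<lparr>carrier = {f. bij f \<and> algebra_hom_on UNIV sc m sc m f}, mult = (\<lambda>f g. g \<circ> f), one = id\<rparr>"

lemma group_Aut_alg: "group (Aut_alg sc m)"
proof (rule groupI)
  show "f \<otimes>\<^bsub>Aut_alg sc m\<^esub> g \<in> carrier (Aut_alg sc m)"
    if "f \<in> carrier (Aut_alg sc m)" "g \<in> carrier (Aut_alg sc m)" for f g
    using that by (simp add: Aut_alg_def algebra_hom_on_def bij_comp)
  show "\<one>\<^bsub>Aut_alg sc m\<^esub> \<in> carrier (Aut_alg sc m)"
    by (simp add: Aut_alg_def algebra_hom_on_def)
  fix f assume f: "f \<in> carrier (Aut_alg sc m)"
  then have b: "bij f" and h: "algebra_hom_on UNIV sc m sc m f"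
    by (simp_all add: Aut_alg_def)
  define g where "g = inv_into UNIV f"
  have fg: "f (g x) = x" and gf: "g (f x) = x" for x
    using b by (simp_all add: g_def bij_is_surj surj_f_inv_f bij_is_inj)
  have "g (x + y) = g x + g y" "g (sc c x) = sc c (g x)" "g (m x y) = m (g x) (g y)" for x y c
    using h gf[of "g x + g y"] gf[of "sc c (g x)"] gf[of "m (g x) (g y)"]
    by (simp_all add: algebra_hom_on_def fg)
  moreover have "bij g"
    using b by (simp add: g_def bij_imp_bij_inv)
  ultimately have "g \<in> carrier (Aut_alg sc m)"
    by (simp add: Aut_alg_def algebra_hom_on_def)
  then show "\<exists>g\<in>carrier (Aut_alg sc m). g \<otimes>\<^bsub>Aut_alg sc m\<^esub> f = \<one>\<^bsub>Aut_alg sc m\<^esub>"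
    by (rule bexI[rotated]) (simp add: Aut_alg_def fg fun_eq_iff)
qed (simp_all add: Aut_alg_def comp_assoc)

definition eigenspace :: "('f::field \<Rightarrow> 'a::ab_group_add \<Rightarrow> 'a) \<Rightarrow> ('a \<Rightarrow> 'a \<Rightarrow> 'a) \<Rightarrow> 'f \<Rightarrow> 'a \<Rightarrow> 'a set"
  where "eigenspace sc m l a = {x. m x a = sc l x}"

definition poly_op :: "('f::field \<Rightarrow> 'a::ab_group_add \<Rightarrow> 'a) \<Rightarrow> 'f poly \<Rightarrow> ('a \<Rightarrow> 'a) \<Rightarrow> 'a \<Rightarrow> 'a"
  where "poly_op sc p T x = (\<Sum>i\<le>degree p. sc (Polynomial.coeff p i) ((T ^^ i) x))"

definition is_min_poly :: "('f::field \<Rightarrow> 'a::ab_group_add \<Rightarrow> 'a) \<Rightarrow> ('a \<Rightarrow> 'a) \<Rightarrow> 'f poly \<Rightarrow> bool"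
  where "is_min_poly sc T p \<longleftrightarrow>
    lead_coeff p = 1 \<and> (\<forall>x. poly_op sc p T x = 0) \<and>
    (\<forall>q. q \<noteq> 0 \<and> (\<forall>x. poly_op sc q T x = 0) \<longrightarrow> degree p \<le> degree q)"

definition set_sum :: "'a::ab_group_add set \<Rightarrow> 'a set \<Rightarrow> 'a set"
  where "set_sum S T = {x + y |x y. x \<in> S \<and> y \<in> T}"

definition eta_axis ::
  "('f::field \<Rightarrow> 'a::ab_group_add \<Rightarrow> 'a) \<Rightarrow> ('a \<Rightarrow> 'a \<Rightarrow> 'a) \<Rightarrow> 'f \<Rightarrow> 'a \<Rightarrow> bool"
  where "eta_axis sc m \<eta> a \<longleftrightarrow>
    (let A = (\<lambda>l. eigenspace sc m l a) in
      a \<noteq> 0 \<and> m a a = a \<and>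
      (\<exists>p. is_min_poly sc (\<lambda>x. m x a) p \<and> p dvd [:-1, 1:] * [:0, 1:] * [:-\<eta>, 1:]) \<and>
      (\<forall>x\<in>A 1. \<forall>y\<in>A 1. m x y \<in> A 1) \<and>
      (\<forall>x\<in>A 0. \<forall>y\<in>A 0. m x y \<in> A 0) \<and>
      (\<forall>x\<in>A 1. \<forall>y\<in>A 0. m x y = 0) \<and>
      (\<forall>x\<in>set_sum (A 0) (A 1). \<forall>y\<in>A \<eta>. m x y \<in> A \<eta>) \<and>
      (\<forall>x\<in>A \<eta>. \<forall>y\<in>A \<eta>. m x y \<in> set_sum (A 0) (A 1)) \<and>
      A 1 = range (\<lambda>c. sc c a))"

definition miyamoto ::
  "('f::field \<Rightarrow> 'a::ab_group_add \<Rightarrow> 'a) \<Rightarrow> ('a \<Rightarrow> 'a \<Rightarrow> 'a) \<Rightarrow> 'f \<Rightarrow> 'a \<Rightarrow> 'a \<Rightarrow> 'a"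
  where "miyamoto sc m \<eta> a = (THE t. Vector_Spaces.linear sc sc t \<and>
    (\<forall>x\<in>set_sum (eigenspace sc m 1 a) (eigenspace sc m 0 a). t x = x) \<and>
    (\<forall>x\<in>eigenspace sc m \<eta> a. t x = - x))"

definition closed_axes ::
  "('f::field \<Rightarrow> 'a::ab_group_add \<Rightarrow> 'a) \<Rightarrow> ('a \<Rightarrow> 'a \<Rightarrow> 'a) \<Rightarrow> 'f \<Rightarrow> 'a set \<Rightarrow> bool"
  where "closed_axes sc m \<eta> X \<longleftrightarrow> (\<forall>a\<in>X. \<forall>b\<in>X. miyamoto sc m \<eta> b a \<in> X)"

definition axis_graph_edges :: "('a::ab_group_add \<Rightarrow> 'a \<Rightarrow> 'a) \<Rightarrow> 'a set \<Rightarrow> ('a \<times> 'a) set"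
  where "axis_graph_edges m X = {(a, b). a \<in> X \<and> b \<in> X \<and> a \<noteq> b \<and> m a b \<noteq> 0}"

definition axis_graph_connected :: "('a::ab_group_add \<Rightarrow> 'a \<Rightarrow> 'a) \<Rightarrow> 'a set \<Rightarrow> bool"
  where "axis_graph_connected m X \<longleftrightarrow> (\<forall>a\<in>X. \<forall>b\<in>X. (a, b) \<in> (axis_graph_edges m X)\<^sup>*)"

definition three_transpositions :: "('g, 'z) monoid_scheme \<Rightarrow> 'g set \<Rightarrow> bool"
  where "three_transpositions G D \<longleftrightarrow>
    group G \<and> D \<subseteq> carrier G \<and> generate G D = carrier G \<and>
    (\<forall>d\<in>D. \<forall>g\<in>carrier G. inv\<^bsub>G\<^esub> g \<otimes>\<^bsub>G\<^esub> d \<otimes>\<^bsub>G\<^esub> g \<in> D) \<and>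
    (\<forall>d\<in>D. group.ord G d = 2) \<and>
    (\<forall>s\<in>D. \<forall>t\<in>D. group.ord G (s \<otimes>\<^bsub>G\<^esub> t) \<in> {1, 2, 3})"

text \<open>
  The vector space with basis D is realised as the finitely supported functions with support
  in D, the basis vector of d being single d 1.
\<close>

definition matsuo_carrier :: "'g set \<Rightarrow> ('g \<Rightarrow>\<^sub>0 'f::field) set"
  where "matsuo_carrier D = {u. Poly_Mapping.keys u \<subseteq> D}"

definition matsuo_scale :: "'f::field \<Rightarrow> ('g \<Rightarrow>\<^sub>0 'f) \<Rightarrow> ('g \<Rightarrow>\<^sub>0 'f)"
  where "matsuo_scale c u = Poly_Mapping.map (\<lambda>b. c * b) u"

text \<open>
  The last branch is never reached when D is a set of 3-transpositions.
\<close>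

definition matsuo_basis_mult :: "'f::field \<Rightarrow> ('g, 'z) monoid_scheme \<Rightarrow> 'g \<Rightarrow> 'g \<Rightarrow> ('g \<Rightarrow>\<^sub>0 'f)"
  where "matsuo_basis_mult \<delta> G x y =
    (if y = x then Poly_Mapping.single x 1
     else if group.ord G (x \<otimes>\<^bsub>G\<^esub> y) = 2 then 0
     else if group.ord G (x \<otimes>\<^bsub>G\<^esub> y) = 3 then
       matsuo_scale \<delta> (Poly_Mapping.single x 1 + Poly_Mapping.single y 1
         - Poly_Mapping.single (inv\<^bsub>G\<^esub> y \<otimes>\<^bsub>G\<^esub> x \<otimes>\<^bsub>G\<^esub> y) 1)
     else 0)"

definition matsuo_mult ::
  "'f::field \<Rightarrow> ('g, 'z) monoid_scheme \<Rightarrow> ('g \<Rightarrow>\<^sub>0 'f) \<Rightarrow> ('g \<Rightarrow>\<^sub>0 'f) \<Rightarrow> ('g \<Rightarrow>\<^sub>0 'f)"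
  where "matsuo_mult \<delta> G u v =
    (\<Sum>x\<in>Poly_Mapping.keys u. \<Sum>y\<in>Poly_Mapping.keys v.
      matsuo_scale (Poly_Mapping.lookup u x * Poly_Mapping.lookup v y) (matsuo_basis_mult \<delta> G x y))"

end

theory Submission
  imports Defs
begin

text \<open>
  Write c for the image of a under tau_b. Decomposing a into eigenvectors of b gives
  ab = l b + (eta/2)(a - c), and symmetrically ab = k a + (eta/2)(b - d) with d the image of b
  under tau_a; distinct axes are linearly independent, so these two expressions can be compared.
  If tau_a and tau_b commute, injectivity of the map from axes to involutions gives c = a and d = b,
  hence ab = l b = k a = 0. If their product has order 3, then
  tau_b tau_a tau_b = tau_a tau_b tau_a, injectivity gives c = d, hence k = l = eta/2. So the axes
  multiply by the rules of the Matsuo algebra.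
\<close>

lemma two_neq_zero_of_CHAR:
  assumes "CHAR('f::field) \<noteq> 2"
  shows "(2::'f) \<noteq> 0"
proof
  assume "(2::'f) = 0"
  then have "of_nat 2 = (0::'f)" by simp
  then have "CHAR('f) dvd 2" by (simp only: of_nat_eq_0_iff_char_dvd)
  then have "CHAR('f) = 1 \<or> CHAR('f) = 2"
    using prime_nat_iff two_is_prime_nat by blast
  then show False using assms CHAR_not_1[where 'a='f] by auto
qed

lemma lookup_matsuo_scale:
  "Poly_Mapping.lookup (matsuo_scale c u) d = c * Poly_Mapping.lookup u d"
  by (simp add: matsuo_scale_def Poly_Mapping.map.rep_eq when_def)

section \<open>Evaluation of polynomials at an operator\<close>

context vector_space
begin

text \<open>Coefficients beyond the degree vanish, so polynomials of different degrees can be summed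
  over one common range.\<close>

lemma poly_op_eq_sum:
  assumes "degree p \<le> n"
  shows "poly_op scale p T x = (\<Sum>i\<le>n. scale (Polynomial.coeff p i) ((T ^^ i) x))"
  unfolding poly_op_def using assms
  by (intro sum.mono_neutral_left) (auto simp: coeff_eq_0)

lemma poly_op_0: "poly_op scale 0 T x = 0"
  by (simp add: poly_op_def)

lemma poly_op_add: "poly_op scale (p + q) T x = poly_op scale p T x + poly_op scale q T x"
  using poly_op_eq_sum[of p "max (degree p) (degree q)"]
    poly_op_eq_sum[of q "max (degree p) (degree q)"]
    poly_op_eq_sum[of "p + q" "max (degree p) (degree q)"]
  by (simp add: degree_add_le_max scale_left_distrib sum.distrib)

lemma poly_op_smult: "poly_op scale (Polynomial.smult c p) T x = scale c (poly_op scale p T x)"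
  using poly_op_eq_sum[OF degree_smult_le[of c p]] by (simp add: poly_op_def scale_sum_right)

text \<open>Shifting the index peels off the innermost application of \<open>T\<close>, which
  becomes part of the argument; this form holds for arbitrary maps \<open>T\<close>.\<close>

lemma poly_op_pCons: "poly_op scale (pCons c p) T x = scale c x + poly_op scale p T (T x)"
proof -
  have "poly_op scale (pCons c p) T x =
      (\<Sum>i\<le>Suc (degree p). scale (Polynomial.coeff (pCons c p) i) ((T ^^ i) x))"
    by (rule poly_op_eq_sum) (rule degree_pCons_le)
  also have "\<dots> = scale c x + poly_op scale p T (T x)"
    by (simp only: sum.atMost_Suc_shift poly_op_def)
      (simp add: funpow_swap1 del: sum.atMost_Suc)
  finally show ?thesis .
qed

text \<open>Induction on \<open>q\<close>: multiplying \<open>p\<close> by \<open>pCons c q\<close>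
  gives \<open>smult c p\<close> plus a shift of \<open>p * q\<close>, and the shift is evaluated at
  \<open>T x\<close>, hence the arbitrary \<open>x\<close>. This passes annihilation from a minimal
  polynomial to its multiples.\<close>

lemma poly_op_mult_eq_0:
  assumes "\<And>x. poly_op scale p T x = 0"
  shows "poly_op scale (p * q) T x = 0"
  by (induction q arbitrary: x)
    (simp_all add: poly_op_0 poly_op_add poly_op_smult poly_op_pCons assms)

end

section \<open>Closure properties of the Matsuo carrier\<close>

lemma matsuo_carrier_0: "0 \<in> matsuo_carrier D"
  and matsuo_carrier_single: "d \<in> D \<Longrightarrow> Poly_Mapping.single d c \<in> matsuo_carrier D"
  by (simp_all add: matsuo_carrier_def)

lemma matsuo_carrier_add: "u \<in> matsuo_carrier D \<Longrightarrow> v \<in> matsuo_carrier D \<Longrightarrow> u + v \<in> matsuo_carrier D"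
  unfolding matsuo_carrier_def using Poly_Mapping.keys_add[of u v] by blast

lemma matsuo_carrier_diff: "u \<in> matsuo_carrier D \<Longrightarrow> v \<in> matsuo_carrier D \<Longrightarrow> u - v \<in> matsuo_carrier D"
  unfolding matsuo_carrier_def using Poly_Mapping.keys_diff[of u v] by blast

lemma matsuo_carrier_scale: "u \<in> matsuo_carrier D \<Longrightarrow> matsuo_scale c u \<in> matsuo_carrier D"
  by (auto simp: matsuo_carrier_def in_keys_iff lookup_matsuo_scale)

lemma matsuo_carrier_sum: "(\<And>i. i \<in> I \<Longrightarrow> f i \<in> matsuo_carrier D) \<Longrightarrow> (\<Sum>i\<in>I. f i) \<in> matsuo_carrier D"
  by (induction I rule: infinite_finite_induct) (simp_all add: matsuo_carrier_0 matsuo_carrier_add)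

text \<open>Only the branch of order 3 brings in a new basis vector, the conjugate of
  \<open>x\<close> by \<open>y\<close>, and it lies in \<open>D\<close> because \<open>D\<close> is
  normal.\<close>

lemma matsuo_carrier_mult:
  assumes G: "three_transpositions G D" and uv: "u \<in> matsuo_carrier D" "v \<in> matsuo_carrier D"
  shows "matsuo_mult \<delta> G u v \<in> matsuo_carrier D"
proof -
  have "matsuo_basis_mult \<delta> G x y \<in> matsuo_carrier D" if "x \<in> D" "y \<in> D" for x y
  proof -
    have "inv\<^bsub>G\<^esub> y \<otimes>\<^bsub>G\<^esub> x \<otimes>\<^bsub>G\<^esub> y \<in> D"
      using G that unfolding three_transpositions_def by blast
    with that show ?thesis
      by (auto simp: matsuo_basis_mult_def
        intro!: matsuo_carrier_0 matsuo_carrier_scale matsuo_carrier_diff matsuo_carrier_add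
          matsuo_carrier_single)
  qed
  then show ?thesis
    unfolding matsuo_mult_def using uv
    by (intro matsuo_carrier_sum matsuo_carrier_scale) (auto simp: matsuo_carrier_def)
qed

section \<open>Bilinearity of the product and linear extension from a basis\<close>

context comm_nonassoc_algebra
begin

lemma m_add_right: "m z (x + y) = m z x + m z y"
  using m_add_left m_commute by metis

lemma m_scale_right: "m x (sc c y) = sc c (m x y)"
  using m_scale_left m_commute by metis

lemma m_zero_left [simp]: "m 0 x = 0"
  using m_scale_left[of 0 0 x] by simp

lemma m_zero_right [simp]: "m x 0 = 0"
  using m_zero_left m_commute by metis

lemma m_minus_left: "m (- x) y = - m x y"
  using m_scale_left[of "-1" x y] by simp

lemma m_diff_left: "m (x - y) z = m x z - m y z"
  using m_add_left[of x "- y" z] by (simp add: m_minus_left)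

lemma m_sum_left: "m (\<Sum>i\<in>I. f i) z = (\<Sum>i\<in>I. m (f i) z)"
  by (induction I rule: infinite_finite_induct) (simp_all add: m_add_left)

lemma m_sum_right: "m z (\<Sum>i\<in>I. f i) = (\<Sum>i\<in>I. m z (f i))"
  by (induction I rule: infinite_finite_induct) (simp_all add: m_add_right)

definition linear_extension :: "('g \<Rightarrow> 'a) \<Rightarrow> ('g \<Rightarrow>\<^sub>0 'f) \<Rightarrow> 'a"
  where "linear_extension h u =
    (\<Sum>d\<in>Poly_Mapping.keys u. sc (Poly_Mapping.lookup u d) (h d))"

text \<open>Enlarging the support to a common finite set lets functions with different supports be
  compared termwise.\<close>

lemma linear_extension_eq_sum:
  fixes u :: "'g \<Rightarrow>\<^sub>0 'f"
  assumes "finite S" "Poly_Mapping.keys u \<subseteq> S"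
  shows "linear_extension h u = (\<Sum>d\<in>S. sc (Poly_Mapping.lookup u d) (h d))"
  unfolding linear_extension_def
  using assms by (intro sum.mono_neutral_left) (auto simp: in_keys_iff)

lemma linear_extension_0 [simp]: "linear_extension h 0 = 0"
  by (simp add: linear_extension_def)

lemma linear_extension_single [simp]: "linear_extension h (Poly_Mapping.single d c) = sc c (h d)"
  by (cases "c = 0") (simp_all add: linear_extension_def)

lemma linear_extension_add: "linear_extension h (u + v) = linear_extension h u + linear_extension h v"
proof -
  let ?S = "Poly_Mapping.keys u \<union> Poly_Mapping.keys v"
  have "Poly_Mapping.keys (u + v) \<subseteq> ?S" by (rule Poly_Mapping.keys_add)
  then show ?thesis
    using linear_extension_eq_sum[of ?S u h] linear_extension_eq_sum[of ?S v h]
      linear_extension_eq_sum[of ?S "u + v" h]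
    by (simp add: lookup_add scale_left_distrib sum.distrib)
qed

lemma linear_extension_diff: "linear_extension h (u - v) = linear_extension h u - linear_extension h v"
  using linear_extension_add[of h "u - v" v] by simp

lemma linear_extension_sum: "linear_extension h (\<Sum>i\<in>I. f i) = (\<Sum>i\<in>I. linear_extension h (f i))"
  by (induction I rule: infinite_finite_induct) (simp_all add: linear_extension_add)

lemma linear_extension_scale: "linear_extension h (matsuo_scale c u) = sc c (linear_extension h u)"
proof -
  have "linear_extension h (matsuo_scale c u) =
      (\<Sum>d\<in>Poly_Mapping.keys u. sc (Poly_Mapping.lookup (matsuo_scale c u) d) (h d))"
    by (rule linear_extension_eq_sum) (auto simp: in_keys_iff lookup_matsuo_scale)
  then show ?thesis by (simp add: linear_extension_def lookup_matsuo_scale scale_sum_right)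
qed

section \<open>Eigenspace decomposition and an explicit Miyamoto map\<close>

text \<open>
  The projection onto the eta-eigenspace of a, given by the Lagrange polynomial
  x(x - 1)/(eta(eta - 1)) evaluated at multiplication by a.
\<close>

definition eta_part :: "'f \<Rightarrow> 'a \<Rightarrow> 'a \<Rightarrow> 'a"
  where "eta_part \<eta> a x = sc (1 / (\<eta> * (\<eta> - 1))) (m (m x a) a - m x a)"

text \<open>The cubic (x - 1)x(x - \<eta>) is a multiple of the minimal polynomial, so it
  annihilates multiplication by \<open>a\<close>; expanding it gives this recursion for the third
  power.\<close>

lemma eta_axis_cubic:
  assumes "eta_axis sc m \<eta> a"
  shows "m (m (m x a) a) a = sc (1 + \<eta>) (m (m x a) a) - sc \<eta> (m x a)"
proof -
  obtain p where p: "is_min_poly sc (\<lambda>x. m x a) p"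
    and "p dvd [:-1, 1:] * [:0, 1:] * [:-\<eta>, 1:]"
    using assms unfolding eta_axis_def Let_def by blast
  then obtain q where q: "[:-1, 1:] * [:0, 1:] * [:-\<eta>, 1:] = p * q"
    by (auto elim: dvdE)
  have "poly_op sc (p * q) (\<lambda>x. m x a) x = 0"
    using p unfolding is_min_poly_def by (intro poly_op_mult_eq_0) blast
  moreover have "[:-1, 1:] * [:0, 1:] * [:-\<eta>, 1:] = [:0, \<eta>, - (1 + \<eta>), 1:]"
    by simp
  ultimately have "sc \<eta> (m x a) - sc (1 + \<eta>) (m (m x a) a) + m (m (m x a) a) a = 0"
    by (simp only: q[symmetric])
      (simp add: poly_op_pCons poly_op_0 scale_left_distrib scale_left_diff_distrib algebra_simps)
  then show ?thesis by (simp add: algebra_simps eq_neg_iff_add_eq_0)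
qed

text \<open>Write T for multiplication by \<open>a\<close>. The cubic relation says that T - \<eta>
  kills the image of T(T - 1). Then T(T - 1) takes the same value on \<open>x\<close> and on
  \<open>e x\<close>, so the remainder satisfies T^2 = T, which encodes membership in A_1 +
  A_0.\<close>

lemma eta_axis_decomposition:
  assumes a: "eta_axis sc m \<eta> a" and \<eta>: "\<eta> \<noteq> 0" "\<eta> \<noteq> 1"
  defines "e \<equiv> eta_part \<eta> a"
  shows "m (e x) a = sc \<eta> (e x)"
    and "m (m (x - e x) a) a = m (x - e x) a"
proof -
  let ?k = "1 / (\<eta> * (\<eta> - 1))"
  let ?u = "m x a" and ?v = "m (m x a) a"
  have nz: "\<eta> * (\<eta> - 1) \<noteq> 0" using \<eta> by simp
  have "m (e x) a = sc ?k (m ?v a - ?v)"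
    by (simp add: e_def eta_part_def m_scale_left m_diff_left)
  also have "m ?v a - ?v = sc \<eta> (?v - ?u)"
    by (simp add: eta_axis_cubic[OF a] scale_left_distrib scale_right_diff_distrib)
  also have "sc ?k (sc \<eta> (?v - ?u)) = sc \<eta> (e x)"
    by (simp add: e_def eta_part_def mult.commute)
  finally show 1: "m (e x) a = sc \<eta> (e x)" .
  have "sc (\<eta> * (\<eta> - 1)) (e x) = ?v - ?u"
    using nz by (simp add: e_def eta_part_def)
  then have "sc (\<eta> * \<eta>) (e x) - sc \<eta> (e x) = ?v - ?u"
    by (simp add: right_diff_distrib scale_left_diff_distrib)
  then show "m (m (x - e x) a) a = m (x - e x) a"
    by (simp add: m_diff_left 1 m_scale_left algebra_simps)
qed

text \<open>The projection vanishes on A_1 + A_0 and is the identity on A_\<eta>, so identity minus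
  twice the projection has the defining properties. Uniqueness holds since every \<open>x\<close>
  splits as remainder plus projection. This removes the definite description.\<close>

lemma miyamoto_eq:
  assumes a: "eta_axis sc m \<eta> a" and \<eta>: "\<eta> \<noteq> 0" "\<eta> \<noteq> 1"
  shows "miyamoto sc m \<eta> a = (\<lambda>x. x - eta_part \<eta> a x - eta_part \<eta> a x)"
  unfolding miyamoto_def
proof (rule the_equality)
  let ?e = "eta_part \<eta> a"
  let ?t = "\<lambda>x. x - ?e x - ?e x"
  let ?F = "set_sum (eigenspace sc m 1 a) (eigenspace sc m 0 a)"
  have e_add: "?e (x + y) = ?e x + ?e y" for x y
    by (simp add: eta_part_def m_add_left scale_right_distrib[symmetric] del: scale_right_distrib)
  have e_scale: "?e (sc c x) = sc c (?e x)" for c x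
    by (simp add: eta_part_def m_scale_left scale_right_diff_distrib mult.commute)
  have "Vector_Spaces.linear sc sc ?t"
    by unfold_locales (simp_all add: e_add e_scale scale_right_diff_distrib)
  moreover have "?t x = x" if x: "x \<in> ?F" for x
  proof -
    obtain y z where "x = y + z" "y \<in> eigenspace sc m 1 a" "z \<in> eigenspace sc m 0 a"
      using x unfolding set_sum_def by blast
    then show ?thesis by (simp add: eta_part_def m_add_left eigenspace_def)
  qed
  moreover have "?t x = - x" if "x \<in> eigenspace sc m \<eta> a" for x
  proof -
    have "m x a = sc \<eta> x" using that by (simp add: eigenspace_def)
    then have "m (m x a) a - m x a = sc (\<eta> * (\<eta> - 1)) x"
      by (simp add: m_scale_left right_diff_distrib scale_left_diff_distrib)
    then have "?e x = x" using \<eta> by (simp add: eta_part_def)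
    then show ?thesis by simp
  qed
  ultimately show "Vector_Spaces.linear sc sc ?t \<and> (\<forall>x\<in>?F. ?t x = x) \<and>
      (\<forall>x\<in>eigenspace sc m \<eta> a. ?t x = - x)" by blast
  fix t assume t: "Vector_Spaces.linear sc sc t \<and> (\<forall>x\<in>?F. t x = x) \<and>
    (\<forall>x\<in>eigenspace sc m \<eta> a. t x = - x)"
  then interpret t: Vector_Spaces.linear sc sc t by blast
  show "t = ?t"
  proof
    fix x
    note dec = eta_axis_decomposition[OF a \<eta>, of x]
    let ?y = "x - ?e x"
    \<comment> \<open>Since T^2 = T on \<open>?y\<close>, the splitting of \<open>?y\<close> into
      T\<open>?y\<close> and \<open>?y\<close> - T\<open>?y\<close> is the one along A_1 and
      A_0.\<close>
    have "m ?y a \<in> eigenspace sc m 1 a" "?y - m ?y a \<in> eigenspace sc m 0 a"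
      using dec(2) by (simp_all add: eigenspace_def m_diff_left)
    then have "m ?y a + (?y - m ?y a) \<in> ?F" unfolding set_sum_def by blast
    then have "t ?y = ?y" using t by simp
    moreover have "t (?e x) = - ?e x" using t dec(1) by (simp add: eigenspace_def)
    moreover have "t x = t ?y + t (?e x)" by (simp flip: t.add)
    ultimately show "t x = ?t x" by simp
  qed
qed

text \<open>Multiplication by \<open>a\<close> sends the remainder into A_1, which is the line
  through \<open>a\<close> by primitivity. It scales the \<eta>-part by \<eta>, and that part is
  half the difference of \<open>x\<close> and its Miyamoto image.\<close>

lemma eta_axis_mult:
  assumes a: "eta_axis sc m \<eta> a" and \<eta>: "\<eta> \<noteq> 0" "\<eta> \<noteq> 1" and two: "(2::'f) \<noteq> 0"
  shows "\<exists>l. m x a = sc l a + sc (\<eta> / 2) (x - miyamoto sc m \<eta> a x)"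
proof -
  let ?e = "eta_part \<eta> a x"
  note dec = eta_axis_decomposition[OF a \<eta>, of x]
  have "m (x - ?e) a \<in> eigenspace sc m 1 a"
    using dec(2) by (simp add: eigenspace_def)
  then obtain l where l: "m (x - ?e) a = sc l a"
    using a unfolding eta_axis_def Let_def by blast
  have "x - miyamoto sc m \<eta> a x = sc 2 ?e"
    unfolding miyamoto_eq[OF a \<eta>] using scale_left_distrib[of 1 1 ?e] by simp
  then have "sc (\<eta> / 2) (x - miyamoto sc m \<eta> a x) = sc \<eta> ?e"
    using two by simp
  moreover have "m x a = m (x - ?e) a + m ?e a" by (simp flip: m_add_left)
  ultimately show ?thesis using l dec(1) by auto
qed

section \<open>Products of two distinct axes\<close>

text \<open>If one axis is n times another, idempotency of both forces n * n = n; n = 0 contradicts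
  that axes are nonzero, n = 1 that they are distinct.\<close>

lemma eta_axes_independent:
  assumes a: "eta_axis sc m \<eta> a" and b: "eta_axis sc m \<eta> b" and "a \<noteq> b"
    and eq: "sc k a = sc l b"
  shows "k = 0" and "l = 0"
proof -
  have nz: "a \<noteq> 0" "b \<noteq> 0" and id: "m a a = a" "m b b = b"
    using a b by (auto simp: eta_axis_def Let_def)
  show "k = 0"
  proof (rule ccontr)
    assume k: "k \<noteq> 0"
    define n where "n = l / k"
    have "sc (1 / k) (sc k a) = sc (1 / k) (sc l b)" using eq by simp
    then have ab: "a = sc n b" using k by (simp add: n_def)
    then have "sc (n * n) b = sc n b" using id by (simp add: m_scale_left m_scale_right)
    then have "n * n = n" using nz by simp
    then have "n = 0 \<or> n = 1" by simp
    then show False using ab nz \<open>a \<noteq> b\<close> by auto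
  qed
  then show "l = 0" using eq nz by auto
qed

lemma eta_axes_mult_fixed:
  assumes a: "eta_axis sc m \<eta> a" and b: "eta_axis sc m \<eta> b" and ab: "a \<noteq> b"
    and \<eta>: "\<eta> \<noteq> 0" "\<eta> \<noteq> 1" and two: "(2::'f) \<noteq> 0"
    and fixed: "miyamoto sc m \<eta> b a = a" "miyamoto sc m \<eta> a b = b"
  shows "m a b = 0"
proof -
  obtain k l where "m a b = sc l b" "m b a = sc k a"
    using eta_axis_mult[OF b \<eta> two, of a] eta_axis_mult[OF a \<eta> two, of b] fixed by auto
  then show ?thesis
    using eta_axes_independent[OF a b ab, of k l] m_commute[of a b] by auto
qed

text \<open>Both expressions for the product contain the same \<open>c\<close>, which cancels on
  comparison and leaves a relation between \<open>a\<close> and \<open>b\<close> alone.\<close>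

lemma eta_axes_mult_braided:
  assumes a: "eta_axis sc m \<eta> a" and b: "eta_axis sc m \<eta> b" and ab: "a \<noteq> b"
    and \<eta>: "\<eta> \<noteq> 0" "\<eta> \<noteq> 1" and two: "(2::'f) \<noteq> 0"
    and c: "miyamoto sc m \<eta> b a = c" "miyamoto sc m \<eta> a b = c"
  shows "m a b = sc (\<eta> / 2) (a + b - c)"
proof -
  obtain l where l: "m a b = sc l b + sc (\<eta> / 2) (a - c)"
    using eta_axis_mult[OF b \<eta> two, of a] c by auto
  obtain k where k: "m b a = sc k a + sc (\<eta> / 2) (b - c)"
    using eta_axis_mult[OF a \<eta> two, of b] c by auto
  have "sc (\<eta> / 2 - k) a = sc (\<eta> / 2 - l) b"
    using l k m_commute[of a b]
    by (simp add: scale_left_diff_distrib scale_right_diff_distrib algebra_simps)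
  then have "\<eta> / 2 - l = 0" using eta_axes_independent[OF a b ab] by blast
  then show ?thesis using l by (simp add: scale_right_diff_distrib scale_right_distrib algebra_simps)
qed

section \<open>Conjugation and involutivity of Miyamoto maps\<close>

text \<open>The projection is built from products and scalars only, so a homomorphism carries the
  one for \<open>a\<close> to the one for \<open>g a\<close>.\<close>

lemma miyamoto_hom:
  assumes g: "algebra_hom_on UNIV sc m sc m g"
    and a: "eta_axis sc m \<eta> a" "eta_axis sc m \<eta> (g a)" and \<eta>: "\<eta> \<noteq> 0" "\<eta> \<noteq> 1"
  shows "g (miyamoto sc m \<eta> a x) = miyamoto sc m \<eta> (g a) (g x)"
proof -
  have g_add: "g (x + y) = g x + g y" and g_scale: "g (sc c x) = sc c (g x)"
    and g_mult: "g (m x y) = m (g x) (g y)" for x y c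
    using g by (auto simp: algebra_hom_on_def)
  have g_diff: "g (x - y) = g x - g y" for x y
    using g_add[of "x - y" y] by simp
  show ?thesis
    unfolding miyamoto_eq[OF a(1) \<eta>] miyamoto_eq[OF a(2) \<eta>]
    by (simp add: eta_part_def g_diff g_scale g_mult)
qed

text \<open>The projection e is idempotent, so 1 - 2e squares to the identity.\<close>

lemma miyamoto_involution:
  assumes a: "eta_axis sc m \<eta> a" and \<eta>: "\<eta> \<noteq> 0" "\<eta> \<noteq> 1"
  shows "miyamoto sc m \<eta> a (miyamoto sc m \<eta> a x) = x"
proof -
  let ?e = "eta_part \<eta> a"
  have e_diff: "?e (x - y) = ?e x - ?e y" for x y
    by (simp add: eta_part_def m_diff_left scale_right_diff_distrib)
  have "m (?e x) a = sc \<eta> (?e x)" by (rule eta_axis_decomposition(1)[OF a \<eta>])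
  then have "m (m (?e x) a) a - m (?e x) a = sc (\<eta> * (\<eta> - 1)) (?e x)"
    by (simp add: m_scale_left right_diff_distrib scale_left_diff_distrib)
  then have "?e (?e x) = ?e x" using \<eta> by (simp add: eta_part_def[of \<eta> a "?e x"])
  then show ?thesis unfolding miyamoto_eq[OF a \<eta>] by (simp add: e_diff)
qed

section \<open>From products of basis vectors to a surjective homomorphism\<close>

lemma matsuo_hom_linear_extension:
  assumes basis: "\<And>x y. x \<in> D \<Longrightarrow> y \<in> D \<Longrightarrow>
    linear_extension h (matsuo_basis_mult \<delta> G x y) = m (h x) (h y)"
  shows "algebra_hom_on (matsuo_carrier D) matsuo_scale (matsuo_mult \<delta> G) sc m (linear_extension h)"
proof -
  have "linear_extension h (matsuo_mult \<delta> G u v) = m (linear_extension h u) (linear_extension h v)"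
    if "u \<in> matsuo_carrier D" "v \<in> matsuo_carrier D" for u v
  proof -
    let ?K = Poly_Mapping.keys and ?l = Poly_Mapping.lookup
    have "linear_extension h (matsuo_mult \<delta> G u v) = (\<Sum>x\<in>?K u. \<Sum>y\<in>?K v.
        sc (?l u x * ?l v y) (linear_extension h (matsuo_basis_mult \<delta> G x y)))"
      by (simp add: matsuo_mult_def linear_extension_sum linear_extension_scale)
    also have "\<dots> = (\<Sum>x\<in>?K u. \<Sum>y\<in>?K v. sc (?l u x * ?l v y) (m (h x) (h y)))"
    proof (intro sum.cong refl)
      fix x y assume "x \<in> ?K u" "y \<in> ?K v"
      then have "x \<in> D" "y \<in> D" using that by (auto simp: matsuo_carrier_def)
      then show "sc (?l u x * ?l v y) (linear_extension h (matsuo_basis_mult \<delta> G x y)) =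
        sc (?l u x * ?l v y) (m (h x) (h y))" by (simp add: basis)
    qed
    also have "\<dots> = m (linear_extension h u) (linear_extension h v)"
      unfolding linear_extension_def m_sum_left
      by (simp add: m_sum_right m_scale_left m_scale_right scale_sum_right mult.commute)
    finally show ?thesis .
  qed
  then show ?thesis
    by (simp add: algebra_hom_on_def linear_extension_add linear_extension_scale)
qed

text \<open>Lets surjectivity be checked on generators: an image that is a subalgebra and contains
  the axes contains their hull.\<close>

lemma subalgebra_linear_extension_image:
  assumes G: "three_transpositions G D"
    and hom: "algebra_hom_on (matsuo_carrier D) matsuo_scale (matsuo_mult \<delta> G) sc m (linear_extension h)"
  shows "subalgebra sc m (linear_extension h ` matsuo_carrier D)"
proof -
  let ?\<phi> = "linear_extension h" and ?M = "matsuo_carrier D"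
  have "subspace (?\<phi> ` ?M)"
  proof (rule subspaceI)
    show "0 \<in> ?\<phi> ` ?M"
      by (rule image_eqI[of _ _ 0]) (simp_all add: matsuo_carrier_0)
    show "x + y \<in> ?\<phi> ` ?M" if "x \<in> ?\<phi> ` ?M" "y \<in> ?\<phi> ` ?M" for x y
      using that by (auto simp flip: linear_extension_add intro: matsuo_carrier_add)
    show "sc c x \<in> ?\<phi> ` ?M" if "x \<in> ?\<phi> ` ?M" for c x
      using that by (auto simp flip: linear_extension_scale intro: matsuo_carrier_scale)
  qed
  moreover have "m x y \<in> ?\<phi> ` ?M" if xy: "x \<in> ?\<phi> ` ?M" "y \<in> ?\<phi> ` ?M" for x y
  proof -
    obtain u v where uv: "u \<in> ?M" "v \<in> ?M" and "x = ?\<phi> u" "y = ?\<phi> v" using xy by blast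
    then have "m x y = ?\<phi> (matsuo_mult \<delta> G u v)" using hom by (simp add: algebra_hom_on_def)
    then show ?thesis using matsuo_carrier_mult[OF G uv] by blast
  qed
  ultimately show ?thesis by (simp add: subalgebra_def)
qed

end

theorem theorem3p1:
  fixes sc :: "'f::field \<Rightarrow> 'a::ab_group_add \<Rightarrow> 'a"
    and m :: "'a \<Rightarrow> 'a \<Rightarrow> 'a"
    and \<eta> :: 'f
    and \<A> :: "'a set"
    and D :: "('a \<Rightarrow> 'a) set"
    and G :: "('a \<Rightarrow> 'a) monoid"
  assumes "CHAR('f) \<noteq> 2"
    and "\<eta> \<noteq> 0" and "\<eta> \<noteq> 1"
    and "comm_nonassoc_algebra sc m"
    and "\<forall>a\<in>\<A>. eta_axis sc m \<eta> a"
    and "closed_axes sc m \<eta> \<A>"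
    and "subalgebra sc m hull \<A> = UNIV"
    and "\<exists>a\<in>\<A>. \<exists>b\<in>\<A>. a \<noteq> b"
    and "axis_graph_connected m \<A>"
    and "D = miyamoto sc m \<eta> ` \<A>"
    and "G = subgroup_generated (Aut_alg sc m) D"
    and "inj_on (miyamoto sc m \<eta>) \<A>"
    and "three_transpositions G D"
  shows "\<exists>\<phi> :: (('a \<Rightarrow> 'a) \<Rightarrow>\<^sub>0 'f) \<Rightarrow> 'a.
    algebra_hom_on (matsuo_carrier D) matsuo_scale (matsuo_mult (\<eta> / 2) G) sc m \<phi> \<and>
    \<phi> ` matsuo_carrier D = UNIV"
proof -
  interpret comm_nonassoc_algebra sc m by fact
  interpret Aut: group "Aut_alg sc m" by (rule group_Aut_alg)
  let ?\<tau> = "miyamoto sc m \<eta>"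
  note \<eta> = \<open>\<eta> \<noteq> 0\<close> \<open>\<eta> \<noteq> 1\<close>
  note closed = \<open>closed_axes sc m \<eta> \<A>\<close>[unfolded closed_axes_def, rule_format]
  note axis = \<open>\<forall>a\<in>\<A>. eta_axis sc m \<eta> a\<close>[rule_format]
  note inj = inj_onD[OF \<open>inj_on ?\<tau> \<A>\<close>]
  note tt = \<open>three_transpositions G D\<close>
  have two: "(2::'f) \<noteq> 0" using \<open>CHAR('f) \<noteq> 2\<close> by (rule two_neq_zero_of_CHAR)
  interpret G: group G using tt by (simp add: three_transpositions_def)

  have DG: "?\<tau> a \<in> carrier G" if "a \<in> \<A>" for a
    using tt that \<open>D = ?\<tau> ` \<A>\<close> by (auto simp: three_transpositions_def)
  \<comment> \<open>Each \<tau>_a is an automorphism because \<open>D\<close> lies in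
    \<open>carrier G\<close> by \<open>tt\<close>, and \<open>carrier G\<close> lies in the
    automorphism group.\<close>
  have "carrier G \<subseteq> carrier (Aut_alg sc m)"
    using Aut.carrier_subgroup_generated_subset[of D] \<open>G = subgroup_generated (Aut_alg sc m) D\<close> by simp
  then have hom: "algebra_hom_on UNIV sc m sc m (?\<tau> a)" if "a \<in> \<A>" for a
    using DG[OF that] by (auto simp: Aut_alg_def)
  \<comment> \<open>Maps act on the right, so group products reverse functional composition.\<close>
  have mult_G: "f \<otimes>\<^bsub>G\<^esub> g = g \<circ> f" for f g
    using \<open>G = subgroup_generated (Aut_alg sc m) D\<close> by (simp add: Aut_alg_def)
  have one_G: "\<one>\<^bsub>G\<^esub> = id"
    using \<open>G = subgroup_generated (Aut_alg sc m) D\<close> by (simp add: Aut_alg_def)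
  have invol: "?\<tau> a (?\<tau> a x) = x" if "a \<in> \<A>" for a x
    using miyamoto_involution[OF axis[OF that] \<eta>] .
  have inv_G: "inv\<^bsub>G\<^esub> (?\<tau> a) = ?\<tau> a" if "a \<in> \<A>" for a
    using that by (intro G.inv_equality) (auto simp: DG mult_G one_G invol)
  \<comment> \<open>Apply \<open>miyamoto_hom\<close> to the automorphism \<tau>_b at the point
    \<tau>_b x; the two applications of \<tau>_b on the other side cancel.\<close>
  have conj: "?\<tau> (?\<tau> b a) x = ?\<tau> b (?\<tau> a (?\<tau> b x))" if "a \<in> \<A>" "b \<in> \<A>" for a b x
    using miyamoto_hom[OF hom axis axis \<eta>, of b a "?\<tau> b x"] that closed invol by simp

  \<comment> \<open>On basis vectors the homomorphism sends \<tau>_a back to its axis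
    \<open>a\<close>, well defined by injectivity.\<close>
  define h where "h = inv_into \<A> ?\<tau>"
  have h: "h (?\<tau> a) = a" if "a \<in> \<A>" for a
    using that \<open>inj_on ?\<tau> \<A>\<close> by (simp add: h_def)
  have "linear_extension h (matsuo_basis_mult (\<eta> / 2) G (?\<tau> a) (?\<tau> b)) = m a b"
    if ab: "a \<in> \<A>" "b \<in> \<A>" for a b
  proof (cases "a = b")
    case True
    then show ?thesis
      using axis[OF \<open>b \<in> \<A>\<close>] h ab by (simp add: matsuo_basis_mult_def eta_axis_def Let_def)
  next
    case False
    note axes = axis[OF \<open>a \<in> \<A>\<close>] axis[OF \<open>b \<in> \<A>\<close>] False
    let ?st = "?\<tau> a \<otimes>\<^bsub>G\<^esub> ?\<tau> b"
    have st: "?st \<in> carrier G" using DG ab by simp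
    have pow: "?st [^]\<^bsub>G\<^esub> (G.ord ?st) = \<one>\<^bsub>G\<^esub>" using st by simp
    have ne: "?\<tau> b \<noteq> ?\<tau> a" using inj ab False by metis
    \<comment> \<open>Order 1 would make \<tau>_b the inverse of \<tau>_a, that is \<tau>_a
      itself.\<close>
    have "G.ord ?st \<noteq> 1"
    proof
      assume "G.ord ?st = 1"
      then have "?\<tau> b \<circ> ?\<tau> a = id"
        using pow st by (simp add: mult_G one_G)
      then have "?\<tau> b (?\<tau> a (?\<tau> a x)) = ?\<tau> a x" for x by (simp add: fun_eq_iff)
      then show False using ne invol ab by auto
    qed
    then consider "G.ord ?st = 2" | "G.ord ?st = 3"
      using tt ab \<open>D = ?\<tau> ` \<A>\<close> unfolding three_transpositions_def by blast
    then show ?thesis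
    proof cases
      case 1
      then have "?st \<otimes>\<^bsub>G\<^esub> ?st = \<one>\<^bsub>G\<^esub>" using pow st by (simp add: numeral_2_eq_2)
      then have "?\<tau> b (?\<tau> a (?\<tau> b (?\<tau> a x))) = x" for x
        by (simp add: mult_G one_G fun_eq_iff)
      then have swap: "?\<tau> b (?\<tau> a x) = ?\<tau> a (?\<tau> b x)" for x
        using invol ab by metis
      then have "?\<tau> (?\<tau> b a) = ?\<tau> a" "?\<tau> (?\<tau> a b) = ?\<tau> b"
        using conj ab invol by (auto simp: fun_eq_iff)
      then have "?\<tau> b a = a" "?\<tau> a b = b" using inj closed ab by blast+
      then have "m a b = 0" by (rule eta_axes_mult_fixed[OF axes \<eta> two])
      then show ?thesis using 1 ne by (simp add: matsuo_basis_mult_def)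
    next
      case 2
      then have "?st \<otimes>\<^bsub>G\<^esub> ?st \<otimes>\<^bsub>G\<^esub> ?st = \<one>\<^bsub>G\<^esub>" using pow st by (simp add: numeral_3_eq_3)
      then have "?\<tau> b (?\<tau> a (?\<tau> b (?\<tau> a (?\<tau> b (?\<tau> a x))))) = x" for x
        by (simp add: mult_G one_G fun_eq_iff)
      \<comment> \<open>The braid relation, from cubing the product to the identity and moving three
        involutions across.\<close>
      then have "?\<tau> b (?\<tau> a (?\<tau> b x)) = ?\<tau> a (?\<tau> b (?\<tau> a x))" for x
        using invol ab by metis
      then have "?\<tau> (?\<tau> b a) = ?\<tau> (?\<tau> a b)"
        using conj ab by (auto simp: fun_eq_iff)
      then have "?\<tau> a b = ?\<tau> b a" using inj closed ab by metis
      then have "m a b = sc (\<eta> / 2) (a + b - ?\<tau> b a)"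
        by (rule eta_axes_mult_braided[OF axes \<eta> two refl])
      \<comment> \<open>The conjugate in the Matsuo product is the involution of the axis
        \<tau>_b(a), so \<open>h\<close> sends it to the third term of the product formula.\<close>
      moreover have "inv\<^bsub>G\<^esub> (?\<tau> b) \<otimes>\<^bsub>G\<^esub> ?\<tau> a \<otimes>\<^bsub>G\<^esub> ?\<tau> b = ?\<tau> (?\<tau> b a)"
        using ab by (simp add: inv_G mult_G fun_eq_iff conj)
      ultimately show ?thesis
        using 2 ne h closed ab
        by (simp add: matsuo_basis_mult_def linear_extension_scale linear_extension_add
          linear_extension_diff)
    qed
  qed
  then have "linear_extension h (matsuo_basis_mult (\<eta> / 2) G x y) = m (h x) (h y)"
    if "x \<in> D" "y \<in> D" for x y
    using that h \<open>D = ?\<tau> ` \<A>\<close> by auto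
  then have \<phi>: "algebra_hom_on (matsuo_carrier D) matsuo_scale (matsuo_mult (\<eta> / 2) G) sc m
      (linear_extension h)"
    by (rule matsuo_hom_linear_extension)
  have "a \<in> linear_extension h ` matsuo_carrier D" if "a \<in> \<A>" for a
    using that h \<open>D = ?\<tau> ` \<A>\<close>
    by (intro image_eqI[of _ _ "Poly_Mapping.single (?\<tau> a) 1"]) (auto intro: matsuo_carrier_single)
  then have "subalgebra sc m hull \<A> \<subseteq> linear_extension h ` matsuo_carrier D"
    by (intro hull_minimal subalgebra_linear_extension_image[OF tt \<phi>] subsetI)
  then show ?thesis using \<open>subalgebra sc m hull \<A> = UNIV\<close> \<phi> by blast
qed

end
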